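(* Let $\mathcal{B}$ be a basis of a real Banach space $\mathbb{X}$. Then $\mathcal{B}$ is almost-greedy if and only if there exists $C>0$ such that $$\|x-\mathcal{G}_m(x)\|\le C\,\mathcal{H}_m(x)\quad\text{for every }x\in\mathbb{X}\text{ and }m\in\mathbb{N}.$$
   Context: Let $(\mathbb{X},\|\cdot\|)$ be a real Banach space. A "basis" of $\mathbb{X}$ means a semi-normalized Schauder basis $\mathcal{B}=(e_n)_{n=1}^{\infty}$ with biorthogonal functionals $(e_n^* )_{n=1}^\infty\subset\mathbb{X}^*$, i.e.: (i) there exist $a,b>0$ with $a\le\|e_n\|,\|e_n^*\|\le b$ for all $n\in\mathbb{N}$; (ii) $e_k^*(e_n)=\delta_{kn}$ for all $k,n$; (iii) the projections $P_m(x)=\sum_{n=1}^m e_n^*(x)e_n$ satisfy $\lim_m\|P_m(x)-x\|=0$ for every $x\in\mathbb{X}$. Greedy sums: for $x\in\mathbb{X}$ let $\rho:\mathbb{N}\to\mathbb{N}$ be the rearranging function such that if $j<k$ then either $|e_{\rho(j)}^*(x)|>|e_{\rho(k)}^*(x)|$, or $|e_{\rho(j)}^*(x)|=|e_{\rho(k)}^*(x)|$ and $\rho(j)<\rho(k)$ (coefficients are taken in decreasing order of modulus, ties broken by smaller index). The $m$-th greedy set of $x$ is $\Lambda_m(x)=\{\rho(n):n\le m\}$ and the $m$-th greedy sum is $\mathcal{G}_m(x)=\sum_{k\in\Lambda_m(x)}e_k^*(x)e_k$. For a finite set $A\subset\mathbb{N}$, $|A|$ is its cardinality and $\mathbf{1}_A=\sum_{n\in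 A}e_n$. For finite $A,B\subset\mathbb{N}$ write $A<B$ if $\max A<\min B$, and $A>B$ if $B<A$. Define $$\mathcal{H}_m(x)=\inf\{\|x-\alpha\mathbf{1}_A\|:\alpha\in\mathbb{R},\ A\subset\mathbb{N},\ |A|=m,\text{ and either }A<\Lambda_m(x)\text{ or }A>\Lambda_m(x)\}.$$ The basis $\mathcal{B}$ is almost-greedy if there exists $C>0$ such that $\|x-\mathcal{G}_m(x)\|\le C\,\widetilde{\sigma}_m(x)$ for all $x\in\mathbb{X}$ and $m\in\mathbb{N}$, where $\widetilde{\sigma}_m(x)=\inf\{\|x-\sum_{n\in A}e_n^*(x)e_n\|:A\subset\mathbb{N},\ |A|=m\}$. *)

theory Defs
  imports "HOL-Analysis.Analysis"
begin

text \<open>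
  The index set of a basis is the type \<^typ>\<open>nat\<close>, so indices start at 0: the vector and
  functional with index \<open>n\<close> here are the ones usually numbered \<open>n + 1\<close>. Only the order of the
  indices matters below. Cardinalities \<open>m\<close> are not shifted and range over \<open>m \<ge> 1\<close>.
\<close>

definition seminormalized_schauder_basis ::
    "(nat \<Rightarrow> 'a::real_normed_vector) \<Rightarrow> (nat \<Rightarrow> 'a \<Rightarrow>\<^sub>L real) \<Rightarrow> bool" where
  "seminormalized_schauder_basis e e' \<longleftrightarrow>
     (\<exists>a>0. \<exists>b>0. \<forall>n. a \<le> norm (e n) \<and> norm (e n) \<le> b \<and> a \<le> norm (e' n) \<and> norm (e' n) \<le> b) \<and>
     (\<forall>k n. blinfun_apply (e' k) (e n) = (if k = n then 1 else 0)) \<and>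
     (\<forall>x. (\<lambda>m. norm ((\<Sum>n<m. blinfun_apply (e' n) x *\<^sub>R e n) - x)) \<longlonglongrightarrow> 0)"

definition greedy_before ::
    "(nat \<Rightarrow> 'a::real_normed_vector \<Rightarrow>\<^sub>L real) \<Rightarrow> 'a \<Rightarrow> nat \<Rightarrow> nat \<Rightarrow> bool" where
  "greedy_before e' x i k \<longleftrightarrow>
     \<bar>blinfun_apply (e' i) x\<bar> > \<bar>blinfun_apply (e' k) x\<bar> \<or>
     \<bar>blinfun_apply (e' i) x\<bar> = \<bar>blinfun_apply (e' k) x\<bar> \<and> i < k"

text \<open>
  The second conjunct says that no index is skipped: an index that is never listed comes after all
  listed ones. It is implicit in speaking of \<^emph>\<open>the\<close> rearranging function; without it the first
  conjunct would not determine \<open>\<rho>\<close>. Surjectivity cannot be required instead, since indices with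
  zero coefficient are never reached when infinitely many coefficients are nonzero.
\<close>

definition greedy_rearranging ::
    "(nat \<Rightarrow> 'a::real_normed_vector \<Rightarrow>\<^sub>L real) \<Rightarrow> 'a \<Rightarrow> (nat \<Rightarrow> nat) \<Rightarrow> bool" where
  "greedy_rearranging e' x \<rho> \<longleftrightarrow>
     (\<forall>j k. j < k \<longrightarrow> greedy_before e' x (\<rho> j) (\<rho> k)) \<and>
     (\<forall>i. i \<notin> range \<rho> \<longrightarrow> (\<forall>j. greedy_before e' x (\<rho> j) i))"

definition greedy_rho ::
    "(nat \<Rightarrow> 'a::real_normed_vector \<Rightarrow>\<^sub>L real) \<Rightarrow> 'a \<Rightarrow> nat \<Rightarrow> nat" where
  "greedy_rho e' x = (THE \<rho>. greedy_rearranging e' x \<rho>)"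

definition greedy_set ::
    "(nat \<Rightarrow> 'a::real_normed_vector \<Rightarrow>\<^sub>L real) \<Rightarrow> nat \<Rightarrow> 'a \<Rightarrow> nat set" where
  "greedy_set e' m x = greedy_rho e' x ` {..<m}"

definition greedy_sum ::
    "(nat \<Rightarrow> 'a::real_normed_vector) \<Rightarrow> (nat \<Rightarrow> 'a \<Rightarrow>\<^sub>L real) \<Rightarrow> nat \<Rightarrow> 'a \<Rightarrow> 'a" where
  "greedy_sum e e' m x = (\<Sum>k\<in>greedy_set e' m x. blinfun_apply (e' k) x *\<^sub>R e k)"

text \<open>Only used for nonempty finite sets, since \<open>m \<ge> 1\<close> throughout.\<close>

definition set_before :: "nat set \<Rightarrow> nat set \<Rightarrow> bool" where
  "set_before A B \<longleftrightarrow> Max A < Min B"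

definition H_error ::
    "(nat \<Rightarrow> 'a::real_normed_vector) \<Rightarrow> (nat \<Rightarrow> 'a \<Rightarrow>\<^sub>L real) \<Rightarrow> nat \<Rightarrow> 'a \<Rightarrow> real" where
  "H_error e e' m x =
     Inf {norm (x - \<alpha> *\<^sub>R (\<Sum>n\<in>A. e n)) | \<alpha> A.
            finite A \<and> card A = m \<and>
            (set_before A (greedy_set e' m x) \<or> set_before (greedy_set e' m x) A)}"

definition sigma_tilde ::
    "(nat \<Rightarrow> 'a::real_normed_vector) \<Rightarrow> (nat \<Rightarrow> 'a \<Rightarrow>\<^sub>L real) \<Rightarrow> nat \<Rightarrow> 'a \<Rightarrow> real" where
  "sigma_tilde e e' m x =
     Inf {norm (x - (\<Sum>n\<in>A. blinfun_apply (e' n) x *\<^sub>R e n)) | A. finite A \<and> card A = m}"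

definition almost_greedy ::
    "(nat \<Rightarrow> 'a::real_normed_vector) \<Rightarrow> (nat \<Rightarrow> 'a \<Rightarrow>\<^sub>L real) \<Rightarrow> bool" where
  "almost_greedy e e' \<longleftrightarrow>
     (\<exists>C>0. \<forall>x. \<forall>m\<ge>1. norm (x - greedy_sum e e' m x) \<le> C * sigma_tilde e e' m x)"

lemma basis_coeff_tendsto_0:
  assumes "seminormalized_schauder_basis e e'"
  shows "(\<lambda>n. blinfun_apply (e' n) x) \<longlonglongrightarrow> 0"
proof -
  let ?P = "\<lambda>m. \<Sum>n<m. blinfun_apply (e' n) x *\<^sub>R e n"
  obtain a where a: "a > 0" "\<And>n. a \<le> norm (e n)"
    using assms unfolding seminormalized_schauder_basis_def by blast
  have "(\<lambda>m. norm (?P m - x)) \<longlonglongrightarrow> 0"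
    using assms unfolding seminormalized_schauder_basis_def by blast
  then have P: "?P \<longlonglongrightarrow> x"
    using LIM_zero_cancel tendsto_norm_zero_iff by blast
  have "(\<lambda>m. ?P (Suc m) - ?P m) \<longlonglongrightarrow> x - x"
    by (intro tendsto_diff P LIMSEQ_Suc)
  then have "(\<lambda>m. blinfun_apply (e' m) x *\<^sub>R e m) \<longlonglongrightarrow> 0"
    by simp
  then have lim: "(\<lambda>m. norm (blinfun_apply (e' m) x *\<^sub>R e m) / a) \<longlonglongrightarrow> 0"
    using tendsto_divide[OF tendsto_norm_zero tendsto_const, of _ sequentially a] a(1) by fastforce
  have "norm (blinfun_apply (e' m) x) \<le> norm (blinfun_apply (e' m) x *\<^sub>R e m) / a" for m
    using a mult_left_mono[OF a(2)[of m], of "\<bar>blinfun_apply (e' m) x\<bar>"]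
    by (simp add: pos_le_divide_eq)
  then show ?thesis
    by (intro Lim_null_comparison[OF _ lim]) simp
qed

lemma greedy_before_least:
  assumes "seminormalized_schauder_basis e e'" and "S \<noteq> {}"
  shows "\<exists>i\<in>S. \<forall>k\<in>S. k \<noteq> i \<longrightarrow> greedy_before e' x i k"
proof -
  let ?c = "\<lambda>n. \<bar>blinfun_apply (e' n) x\<bar>"
  have "\<exists>i\<in>S. \<forall>k\<in>S. ?c k \<le> ?c i"
  proof (cases "\<exists>s\<in>S. ?c s > 0")
    case True
    then obtain s where s: "s \<in> S" "?c s > 0" by blast
    have "eventually (\<lambda>n. ?c n < ?c s) sequentially"
      using order_tendstoD(2)[OF tendsto_rabs_zero[OF basis_coeff_tendsto_0[OF assms(1)]] s(2)] .
    then obtain N where N: "\<And>n. n \<ge> N \<Longrightarrow> ?c n < ?c s"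
      unfolding eventually_sequentially by blast
    let ?T = "{n\<in>S. ?c s \<le> ?c n}"
    have "?T \<subseteq> {..<N}"
      using N by (force simp: not_less[symmetric])
    then have fin: "finite ?T"
      using finite_subset by blast
    have "Max (?c ` ?T) \<in> ?c ` ?T"
      using fin s(1) by (intro Max_in) auto
    then obtain i where i: "i \<in> ?T" "?c i = Max (?c ` ?T)"
      by force
    have "?c k \<le> ?c i" if "k \<in> S" for k
    proof (cases "?c s \<le> ?c k")
      case True
      then show ?thesis
        using that fin i(2) by (auto intro!: Max_ge)
    next
      case False
      then show ?thesis
        using i(1) by auto
    qed
    then show ?thesis
      using i(1) by blast
  next
    case False
    then show ?thesis
      using assms(2) by (metis abs_ge_zero all_not_in_conv not_le order_trans)
  qed
  then obtain i0 where i0: "i0 \<in> S" "\<And>k. k \<in> S \<Longrightarrow> ?c k \<le> ?c i0"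
    by blast
  define i where "i = (LEAST i. i \<in> S \<and> ?c i = ?c i0)"
  have i: "i \<in> S" "?c i = ?c i0"
    unfolding i_def using LeastI[of "\<lambda>i. i \<in> S \<and> ?c i = ?c i0" i0] i0(1) by auto
  have "greedy_before e' x i k" if "k \<in> S" "k \<noteq> i" for k
  proof (cases "?c k = ?c i0")
    case True
    then have "i \<le> k"
      unfolding i_def using that by (intro Least_le) auto
    then show ?thesis
      using True that i unfolding greedy_before_def by auto
  next
    case False
    then show ?thesis
      using i i0(2)[OF that(1)] unfolding greedy_before_def by auto
  qed
  then show ?thesis
    using i(1) by blast
qed

lemma greedy_rearranging_next:
  assumes "greedy_rearranging e' x \<rho>"
  shows "\<rho> n \<notin> \<rho> ` {..<n}" and
    "\<And>k. k \<notin> \<rho> ` {..<n} \<Longrightarrow> k \<noteq> \<rho> n \<Longrightarrow> greedy_before e' x (\<rho> n) k"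
proof -
  have irrefl: "\<not> greedy_before e' x i i" for i
    unfolding greedy_before_def by auto
  show "\<rho> n \<notin> \<rho> ` {..<n}"
    using assms irrefl unfolding greedy_rearranging_def by (metis imageE lessThan_iff)
  show "greedy_before e' x (\<rho> n) k" if "k \<notin> \<rho> ` {..<n}" "k \<noteq> \<rho> n" for k
  proof (cases "k \<in> range \<rho>")
    case True
    then obtain j where j: "k = \<rho> j" by blast
    then have "n < j"
      using that by (metis imageI lessThan_iff linorder_neqE_nat)
    then show ?thesis
      using assms j unfolding greedy_rearranging_def by blast
  next
    case False
    then show ?thesis
      using assms unfolding greedy_rearranging_def by blast
  qed
qed

lemma ex1_greedy_rearranging:
  assumes "seminormalized_schauder_basis e e'"
  shows "\<exists>!\<rho>. greedy_rearranging e' x \<rho>"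
proof -
  have asym: "\<not> (greedy_before e' x i k \<and> greedy_before e' x k i)" for i k
    unfolding greedy_before_def by auto
  define first where
    "first S = (SOME i. i \<in> S \<and> (\<forall>k\<in>S. k \<noteq> i \<longrightarrow> greedy_before e' x i k))" for S
  have first: "first S \<in> S" "\<And>k. k \<in> S \<Longrightarrow> k \<noteq> first S \<Longrightarrow> greedy_before e' x (first S) k"
    if "S \<noteq> {}" for S
    using someI_ex[OF greedy_before_least[OF assms that, of x, unfolded Bex_def]]
    unfolding first_def by blast+
  define \<rho> where "\<rho> = wfrec less_than (\<lambda>f n. first (- f ` {..<n}))"
  have rec: "\<rho> n = first (- \<rho> ` {..<n})" for n
  proof -
    have "cut \<rho> less_than n ` {..<n} = \<rho> ` {..<n}"
      by (intro image_cong) (auto simp: cut_apply)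
    then show ?thesis
      using wfrec[OF wf_less_than, of "\<lambda>f n. first (- f ` {..<n})" n]
      unfolding \<rho>_def by simp
  qed
  have ne: "- \<rho> ` {..<n} \<noteq> {}" for n
    using infinite_UNIV_nat by (metis Compl_empty_eq double_complement finite_imageI finite_lessThan)
  have new: "\<rho> n \<notin> \<rho> ` {..<n}"
    and least: "\<And>k. k \<notin> \<rho> ` {..<n} \<Longrightarrow> k \<noteq> \<rho> n \<Longrightarrow> greedy_before e' x (\<rho> n) k" for n
    using first[OF ne[of n]] rec[of n] by auto
  have "greedy_before e' x (\<rho> j) (\<rho> k)" if "j < k" for j k
  proof (rule least)
    show "\<rho> k \<notin> \<rho> ` {..<j}"
      using new[of k] that by fastforce
    show "\<rho> k \<noteq> \<rho> j"
      using new[of k] that by blast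
  qed
  moreover have "greedy_before e' x (\<rho> j) i" if "i \<notin> range \<rho>" for i j
    using that by (intro least) auto
  ultimately have ex: "greedy_rearranging e' x \<rho>"
    unfolding greedy_rearranging_def by blast
  have "\<rho>' = \<rho>" if "greedy_rearranging e' x \<rho>'" for \<rho>'
  proof
    show "\<rho>' n = \<rho> n" for n
    proof (induction n rule: less_induct)
      case (less n)
      then have "\<rho>' ` {..<n} = \<rho> ` {..<n}"
        by (intro image_cong) auto
      then have "greedy_before e' x (\<rho>' n) (\<rho> n) \<and> greedy_before e' x (\<rho> n) (\<rho>' n)"
        if "\<rho>' n \<noteq> \<rho> n"
        using that least new greedy_rearranging_next[OF \<open>greedy_rearranging e' x \<rho>'\<close>]
        by metis
      then show ?case
        using asym by blast
    qed
  qed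
  then show ?thesis
    using ex by blast
qed

end

theory Submission
  imports Defs
begin

text \<open>
  Both properties are equivalent to the conjunction of two simpler ones, up to a change of
  constants: removing a greedy set does not increase the norm by more than a factor
  (\<open>quasi_greedy\<close>), and a finite sum is dominated by any other finite sum that has at least as many
  terms and coefficients at least as large (\<open>large_dominates_small\<close>). The second is a form of democracy in
  which signs and sizes of the coefficients are already taken care of. The sets of indices in it
  may overlap; it is reduced to disjoint sets by passing through an auxiliary set of indices far to
  the right. In a Schauder basis far blocks of coordinates are negligible, and a set far to the
  right also satisfies the order condition in \<^const>\<open>H_error\<close>. So both error functionals can be
  tested against such sets.

  \<^item> Each property implies the pair. Quasi-greediness comes from comparing with \<open>\<alpha> = 0\<close>, or with
    the removal of nothing. Domination comes from applying the inequality to a sum over two disjoint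
    sets, in which the larger coefficients form the greedy set. For \<^const>\<open>H_error\<close> the smaller
    coefficients must then be constant (\<open>greedy_beats_constant_imp_large_dominates_small\<close>);
    convexity extends the estimate from constant coefficients to bounded ones.
  \<^item> The pair implies almost-greediness (\<open>almost_greedyI\<close>). Let \<open>L\<close> be greedy for \<open>x\<close>, let \<open>A\<close> have
    the same size, and let \<open>y\<close> be \<open>x\<close> with the coordinates in \<open>A\<close> removed. Then \<open>L - A\<close> is greedy
    for \<open>y\<close>, and \<open>x\<close> without \<open>L\<close> is \<open>y\<close> without \<open>L - A\<close> plus the part of \<open>x\<close> on \<open>A - L\<close>, which
    the part of \<open>y\<close> on \<open>L - A\<close> dominates.
  \<^item> The pair implies the bound by \<^const>\<open>H_error\<close> (\<open>norm_greedy_remainder_le_constant_error\<close>).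
    Let \<open>y\<close> be \<open>x\<close> minus \<open>\<alpha>\<close> times the indicator sum of \<open>A\<close>, with \<open>A\<close> disjoint from \<open>L\<close>. Adding to \<open>L\<close> the
    indices of \<open>A\<close> at which \<open>y\<close> is large gives a greedy set for \<open>y\<close>. What remains of \<open>x\<close>
    differs from what remains of \<open>y\<close> only on \<open>A\<close>, in terms that the greedy part of \<open>y\<close> dominates.

  Ties are handled by perturbation: an arbitrary choice among tied coefficients becomes the only
  possible one after the chosen coefficients are slightly enlarged (\<open>weakly_greedy_approx\<close>).
\<close>

section \<open>Coordinate projections\<close>

locale seminormalized_basis =
  fixes e :: "nat \<Rightarrow> 'a::real_normed_vector" and e' :: "nat \<Rightarrow> 'a \<Rightarrow>\<^sub>L real"
  assumes basis: "seminormalized_schauder_basis e e'"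
begin

abbreviation coef :: "nat \<Rightarrow> 'a \<Rightarrow> real" where
  "coef n x \<equiv> blinfun_apply (e' n) x"

definition proj :: "nat set \<Rightarrow> 'a \<Rightarrow> 'a" where
  "proj A x = (\<Sum>n\<in>A. coef n x *\<^sub>R e n)"

lemma coef_basis: "coef k (e n) = (if k = n then 1 else 0)"
  using basis unfolding seminormalized_schauder_basis_def by blast

lemma coef_sum:
  assumes "finite A"
  shows "coef k (\<Sum>n\<in>A. c n *\<^sub>R e n) = (if k \<in> A then c k else 0)"
proof -
  have "coef k (\<Sum>n\<in>A. c n *\<^sub>R e n) = (\<Sum>n\<in>A. if k = n then c n else 0)"
    by (auto simp: blinfun.sum_right blinfun.scaleR_right coef_basis intro!: sum.cong)
  also have "\<dots> = (if k \<in> A then c k else 0)"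
    using assms by simp
  finally show ?thesis .
qed

lemma proj_sum:
  assumes "finite A" "finite B"
  shows "proj A (\<Sum>n\<in>B. c n *\<^sub>R e n) = (\<Sum>n\<in>A \<inter> B. c n *\<^sub>R e n)"
  unfolding proj_def sum.inter_restrict[OF assms(1)]
  by (intro sum.cong refl) (simp add: coef_sum assms(2))

lemma proj_add: "proj A (x + y) = proj A x + proj A y"
  by (simp add: proj_def blinfun.add_right scaleR_add_left sum.distrib)

lemma proj_diff: "proj A (x - y) = proj A x - proj A y"
  by (simp add: proj_def blinfun.diff_right scaleR_diff_left sum_subtractf)

lemma proj_Un_disjoint:
  "finite A \<Longrightarrow> finite B \<Longrightarrow> A \<inter> B = {} \<Longrightarrow> proj (A \<union> B) x = proj A x + proj B x"
  by (simp add: proj_def sum.union_disjoint)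

lemma proj_cong: "(\<And>n. n \<in> A \<Longrightarrow> coef n x = coef n y) \<Longrightarrow> proj A x = proj A y"
  by (simp add: proj_def)

lemma tendsto_proj: "X \<longlonglongrightarrow> x \<Longrightarrow> (\<lambda>k. proj A (X k)) \<longlonglongrightarrow> proj A x"
  unfolding proj_def by (intro tendsto_intros)

text \<open>
  The blocks have constant length, and each is a difference of two partial sums of the expansion
  of \<open>x\<close>.
\<close>

lemma proj_far_block_tendsto_0: "(\<lambda>k. proj {k..<k + j} x) \<longlonglongrightarrow> 0"
proof -
  have "(\<lambda>m. norm (proj {..<m} x - x)) \<longlonglongrightarrow> 0"
    using basis unfolding seminormalized_schauder_basis_def proj_def by blast
  then have P: "(\<lambda>m. proj {..<m} x) \<longlonglongrightarrow> x"
    using LIM_zero_cancel tendsto_norm_zero_iff by blast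
  have "(\<lambda>k. proj {..<k + j} x - proj {..<k} x) \<longlonglongrightarrow> x - x"
    by (intro tendsto_diff P LIMSEQ_ignore_initial_segment)
  moreover have "proj {..<k + j} x = proj {..<k} x + proj {k..<k + j} x" for k
    by (subst proj_Un_disjoint[symmetric]) (auto intro!: arg_cong[of _ _ "\<lambda>A. proj A x"])
  ultimately show ?thesis
    by simp
qed


section \<open>Greedy sets with ties\<close>

text \<open>
  Unlike \<^const>\<open>greedy_set\<close>, this leaves the choice among tied coefficients free, so that
  the vector of interest can be tested on any of the possible sets.
\<close>

definition weakly_greedy :: "'a \<Rightarrow> nat set \<Rightarrow> bool" where
  "weakly_greedy x L \<longleftrightarrow> finite L \<and> (\<forall>i\<in>L. \<forall>k. k \<notin> L \<longrightarrow> \<bar>coef k x\<bar> \<le> \<bar>coef i x\<bar>)"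

lemma weakly_greedyI:
  assumes "finite L" "\<And>i. i \<in> L \<Longrightarrow> t \<le> \<bar>coef i x\<bar>" "\<And>k. k \<notin> L \<Longrightarrow> \<bar>coef k x\<bar> \<le> t"
  shows "weakly_greedy x L"
  unfolding weakly_greedy_def using assms order_trans by blast

lemma greedy_set_props:
  shows "finite (greedy_set e' m x)" "card (greedy_set e' m x) = m"
    "weakly_greedy x (greedy_set e' m x)"
proof -
  let ?r = "greedy_rho e' x"
  have r: "greedy_rearranging e' x ?r"
    unfolding greedy_rho_def by (rule theI'[OF ex1_greedy_rearranging[OF basis]])
  have "inj ?r"
    using greedy_rearranging_next(1)[OF r]
    by (intro injI) (metis imageI lessThan_iff linorder_neqE_nat)
  then show "card (greedy_set e' m x) = m"
    unfolding greedy_set_def by (simp add: card_image inj_on_subset)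
  show fin: "finite (greedy_set e' m x)"
    unfolding greedy_set_def by simp
  have "\<bar>coef k x\<bar> \<le> \<bar>coef i x\<bar>" if i: "i \<in> greedy_set e' m x" and k: "k \<notin> greedy_set e' m x" for i k
  proof -
    obtain j where j: "j < m" "i = ?r j"
      using i unfolding greedy_set_def by auto
    have "k \<notin> ?r ` {..<j}" "k \<noteq> ?r j"
      using k j(1) unfolding greedy_set_def by auto
    then have "greedy_before e' x (?r j) k"
      by (rule greedy_rearranging_next(2)[OF r])
    then show ?thesis
      using j unfolding greedy_before_def by auto
  qed
  then show "weakly_greedy x (greedy_set e' m x)"
    unfolding weakly_greedy_def using fin by blast
qed

lemma greedy_set_eqI:
  assumes "finite L" "card L = m"
    and strict: "\<And>i k. i \<in> L \<Longrightarrow> k \<notin> L \<Longrightarrow> \<bar>coef k x\<bar> < \<bar>coef i x\<bar>"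
  shows "greedy_set e' m x = L"
proof (rule ccontr)
  assume ne: "greedy_set e' m x \<noteq> L"
  note G = greedy_set_props[where m = m and x = x]
  have "\<not> L \<subseteq> greedy_set e' m x" "\<not> greedy_set e' m x \<subseteq> L"
    using ne G(1,2) assms(1,2) card_subset_eq by metis+
  then obtain i k where "i \<in> L" "i \<notin> greedy_set e' m x" "k \<in> greedy_set e' m x" "k \<notin> L"
    by blast
  then show False
    using strict[of i k] G(3) unfolding weakly_greedy_def by force
qed

text \<open>
  Moving every coefficient in \<open>L\<close> away from \<open>0\<close> by the same small amount makes \<open>L\<close> the greedy set
  and changes \<open>x\<close> only on \<open>L\<close>. The remainder is therefore exactly the same, and estimates for
  greedy sums pass to \<open>L\<close> by a limit on the right-hand side only.
\<close>

lemma weakly_greedy_approx: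
  assumes "weakly_greedy x L"
  obtains X where "X \<longlonglongrightarrow> x"
    "\<And>k. greedy_set e' (card L) (X k) = L"
    "\<And>k. X k - greedy_sum e e' (card L) (X k) = x - proj L x"
proof -
  have fin: "finite L"
    using assms unfolding weakly_greedy_def by blast
  \<comment> \<open>A zero coefficient also gets a nonzero sign, so that it moves as well.\<close>
  define s where "s n = (if coef n x \<ge> 0 then 1 else -1 :: real)" for n
  define u where "u = (\<Sum>n\<in>L. s n *\<^sub>R e n)"
  define X where "X k = x + inverse (real (Suc k)) *\<^sub>R u" for k
  have "X \<longlonglongrightarrow> x + 0 *\<^sub>R u"
    unfolding X_def by (intro tendsto_intros LIMSEQ_inverse_real_of_nat)
  then have lim: "X \<longlonglongrightarrow> x"
    by simp
  have coefX: "coef n (X k) = coef n x + inverse (real (Suc k)) * (if n \<in> L then s n else 0)" for n k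
    unfolding X_def u_def by (simp add: blinfun.add_right blinfun.scaleR_right coef_sum[OF fin])
  have G: "greedy_set e' (card L) (X k) = L" for k
  proof (rule greedy_set_eqI[OF fin refl])
    fix i j assume i: "i \<in> L" and j: "j \<notin> L"
    define d where "d = inverse (real (Suc k))"
    have "d > 0"
      by (simp add: d_def)
    then have "\<bar>coef i (X k)\<bar> = \<bar>coef i x\<bar> + d"
      using i unfolding coefX d_def[symmetric] by (simp add: s_def)
    moreover have "\<bar>coef j (X k)\<bar> \<le> \<bar>coef i x\<bar>"
      using assms i j by (simp add: coefX weakly_greedy_def)
    ultimately show "\<bar>coef j (X k)\<bar> < \<bar>coef i (X k)\<bar>"
      using \<open>d > 0\<close> by linarith
  qed
  have "proj L (inverse (real (Suc k)) *\<^sub>R u) = inverse (real (Suc k)) *\<^sub>R u" for k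
    using proj_sum[OF fin fin, of "\<lambda>n. inverse (real (Suc k)) * s n"]
    by (simp add: u_def scaleR_sum_right)
  then have "X k - greedy_sum e e' (card L) (X k) = x - proj L x" for k
    unfolding greedy_sum_def G proj_def[symmetric] by (simp add: X_def proj_add)
  with lim G show thesis
    by (rule that)
qed


section \<open>Quasi-greediness and domination\<close>

definition quasi_greedy :: "real \<Rightarrow> bool" where
  "quasi_greedy C \<longleftrightarrow> (\<forall>x L. weakly_greedy x L \<longrightarrow> norm (x - proj L x) \<le> C * norm x)"

text \<open>
  The sets may overlap. Taking all coefficients \<open>\<plusminus>1\<close> gives super-democracy.
\<close>

definition large_dominates_small :: "real \<Rightarrow> bool" where
  "large_dominates_small K \<longleftrightarrow> (\<forall>A B c b. finite A \<longrightarrow> finite B \<longrightarrow> card A \<le> card B \<longrightarrow>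
     (\<forall>i\<in>A. \<forall>k\<in>B. \<bar>c i\<bar> \<le> \<bar>b k\<bar>) \<longrightarrow>
     norm (\<Sum>n\<in>A. c n *\<^sub>R e n) \<le> K * norm (\<Sum>n\<in>B. b n *\<^sub>R e n))"

lemma quasi_greedyD:
  "quasi_greedy C \<Longrightarrow> weakly_greedy x L \<Longrightarrow> norm (x - proj L x) \<le> C * norm x"
  unfolding quasi_greedy_def by blast

lemma quasi_greedy_proj:
  assumes "quasi_greedy C" "weakly_greedy x L"
  shows "norm (proj L x) \<le> (1 + C) * norm x"
proof -
  have "norm (proj L x) \<le> norm x + norm (x - proj L x)"
    using norm_triangle_ineq4[of x "x - proj L x"] by simp
  then show ?thesis
    using quasi_greedyD[OF assms] by (simp add: algebra_simps)
qed

lemma large_dominates_smallD: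
  assumes "large_dominates_small K" "finite A" "finite B" "card A \<le> card B"
    "\<And>i k. i \<in> A \<Longrightarrow> k \<in> B \<Longrightarrow> \<bar>c i\<bar> \<le> \<bar>b k\<bar>"
  shows "norm (\<Sum>n\<in>A. c n *\<^sub>R e n) \<le> K * norm (\<Sum>n\<in>B. b n *\<^sub>R e n)"
  using assms unfolding large_dominates_small_def by blast

text \<open>
  A common constant \<open>t\<close> lets a sum of \<open>t e\<^sub>n\<close> over a third set be inserted between the
  two sums. The value \<open>0\<close> covers an empty \<open>A\<close>.
\<close>

lemma separating_threshold:
  fixes c b :: "nat \<Rightarrow> real"
  assumes "finite A" "\<And>i k. i \<in> A \<Longrightarrow> k \<in> B \<Longrightarrow> \<bar>c i\<bar> \<le> \<bar>b k\<bar>"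
  obtains t where "t \<ge> 0" "\<And>i. i \<in> A \<Longrightarrow> \<bar>c i\<bar> \<le> t" "\<And>k. k \<in> B \<Longrightarrow> t \<le> \<bar>b k\<bar>"
proof
  let ?t = "Max (insert 0 ((\<lambda>i. \<bar>c i\<bar>) ` A))"
  show "?t \<ge> 0" "\<And>i. i \<in> A \<Longrightarrow> \<bar>c i\<bar> \<le> ?t" "\<And>k. k \<in> B \<Longrightarrow> ?t \<le> \<bar>b k\<bar>"
    using assms by auto
qed

lemma far_set:
  assumes "finite S"
  obtains F :: "nat set" where "finite F" "card F = m" "\<And>i n. i \<in> S \<Longrightarrow> n \<in> F \<Longrightarrow> i < n"
proof
  let ?N = "Suc (Max (insert 0 S))"
  show "finite {?N..<?N + m}" "card {?N..<?N + m} = m"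
    by auto
  show "i < n" if "i \<in> S" "n \<in> {?N..<?N + m}" for i n
  proof -
    have "i \<le> Max (insert 0 S)"
      using assms that(1) by (intro Max_ge) auto
    then show ?thesis
      using that(2) by simp
  qed
qed

text \<open>
  The test vector for both derivations of domination: removing its greedy part \<open>B\<close> leaves the sum
  over \<open>A\<close>, and removing \<open>A\<close> leaves the sum over \<open>B\<close>.
\<close>

lemma large_part_of_disjoint_sum:
  assumes "finite A" "finite B" "A \<inter> B = {}"
    and small: "\<And>i. i \<in> A \<Longrightarrow> \<bar>c i\<bar> \<le> t" and large: "\<And>k. k \<in> B \<Longrightarrow> t \<le> \<bar>b k\<bar>" and "t \<ge> 0"
  defines "w \<equiv> (\<Sum>n\<in>A. c n *\<^sub>R e n) + (\<Sum>n\<in>B. b n *\<^sub>R e n)"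
  shows "weakly_greedy w B" "proj A w = (\<Sum>n\<in>A. c n *\<^sub>R e n)" "proj B w = (\<Sum>n\<in>B. b n *\<^sub>R e n)"
proof -
  show "weakly_greedy w B"
    using assms(3,6) small large
    by (intro weakly_greedyI[OF assms(2), of t])
      (auto simp: w_def blinfun.add_right coef_sum assms(1,2))
  show "proj A w = (\<Sum>n\<in>A. c n *\<^sub>R e n)" "proj B w = (\<Sum>n\<in>B. b n *\<^sub>R e n)"
    using assms(3) by (simp_all add: w_def proj_add proj_sum assms(1,2) Int_commute)
qed


section \<open>Almost-greediness\<close>

text \<open>
  Almost-greediness in the form in which it is applied: ties are free and \<open>A\<close> may be smaller
  than \<open>L\<close>.
\<close>

definition removal_optimal :: "real \<Rightarrow> bool" where
  "removal_optimal C \<longleftrightarrow> (\<forall>x L A. weakly_greedy x L \<longrightarrow> finite A \<longrightarrow> card A \<le> card L \<longrightarrow>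
     norm (x - proj L x) \<le> C * norm (x - proj A x))"

lemma removal_optimalD:
  "removal_optimal C \<Longrightarrow> weakly_greedy x L \<Longrightarrow> finite A \<Longrightarrow> card A \<le> card L \<Longrightarrow>
     norm (x - proj L x) \<le> C * norm (x - proj A x)"
  unfolding removal_optimal_def by blast

lemma sigma_tilde_le:
  "finite A \<Longrightarrow> card A = m \<Longrightarrow> sigma_tilde e e' m x \<le> norm (x - proj A x)"
  unfolding sigma_tilde_def proj_def by (intro cInf_lower bdd_belowI[of _ 0]) auto

text \<open>
  Ties are removed by perturbation. A set that is too small is enlarged by a block of indices far
  to the right, whose contribution to the right-hand side vanishes in the limit.
\<close>

lemma almost_greedy_imp_removal_optimal:
  assumes "almost_greedy e e'"
  obtains C where "C > 0" "removal_optimal C"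
proof -
  obtain C0 where C0: "C0 > 0"
    "\<And>x m. m \<ge> 1 \<Longrightarrow> norm (x - greedy_sum e e' m x) \<le> C0 * sigma_tilde e e' m x"
    using assms unfolding almost_greedy_def by blast
  \<comment> \<open>The empty greedy set forces a constant of at least \<open>1\<close>.\<close>
  define C where "C = max 1 C0"
  have C: "C \<ge> 1" "C0 \<le> C"
    by (auto simp: C_def)
  have exact: "norm (x - proj L x) \<le> C * norm (x - proj A x)"
    if L: "weakly_greedy x L" and A: "finite A" "card A = card L" for x L A
  proof (cases "card L = 0")
    case True
    then have "L = {}" "A = {}"
      using L A unfolding weakly_greedy_def by auto
    then show ?thesis
      using C mult_right_mono[of 1 C "norm x"] by (simp add: proj_def)
  next
    case False
    obtain X where X: "X \<longlonglongrightarrow> x"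
        "\<And>k. X k - greedy_sum e e' (card L) (X k) = x - proj L x"
      using weakly_greedy_approx[OF L] by metis
    have "norm (x - proj L x) \<le> C * norm (X k - proj A (X k))" for k
    proof -
      have "norm (x - proj L x) \<le> C0 * sigma_tilde e e' (card L) (X k)"
        using C0(2)[of "card L" "X k"] False X(2) by simp
      also have "\<dots> \<le> C0 * norm (X k - proj A (X k))"
        using C0(1) sigma_tilde_le[OF A] by (intro mult_left_mono) auto
      also have "\<dots> \<le> C * norm (X k - proj A (X k))"
        using C by (intro mult_right_mono) auto
      finally show ?thesis .
    qed
    moreover have "(\<lambda>k. C * norm (X k - proj A (X k))) \<longlonglongrightarrow> C * norm (x - proj A x)"
      by (intro tendsto_intros tendsto_proj X(1))
    ultimately show ?thesis
      by (intro LIMSEQ_le_const) auto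
  qed
  have "norm (x - proj L x) \<le> C * norm (x - proj A x)"
    if L: "weakly_greedy x L" and A: "finite A" "card A \<le> card L" for x L A
  proof -
    let ?F = "\<lambda>k. {k..<k + (card L - card A)}"
    have "norm (x - proj L x) \<le> C * norm (x - (proj A x + proj (?F k) x))" if "k \<ge> Suc (Max (insert 0 A))" for k
    proof -
      have disj: "A \<inter> ?F k = {}"
        using that A(1) Max_ge[of "insert 0 A"] by fastforce
      have "card (A \<union> ?F k) = card L"
        using disj A by (subst card_Un_disjoint) auto
      then show ?thesis
        using exact[OF L, of "A \<union> ?F k"] A(1) disj by (simp add: proj_Un_disjoint)
    qed
    moreover have "(\<lambda>k. C * norm (x - (proj A x + proj (?F k) x))) \<longlonglongrightarrow>
        C * norm (x - (proj A x + 0))"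
      by (intro tendsto_intros proj_far_block_tendsto_0)
    ultimately show ?thesis
      by (intro LIMSEQ_le_const) auto
  qed
  then have "removal_optimal C"
    unfolding removal_optimal_def by blast
  then show thesis
    using C(1) that[of C] by simp
qed

lemma removal_optimal_imp_quasi_greedy:
  assumes "removal_optimal C"
  shows "quasi_greedy C"
  unfolding quasi_greedy_def
proof (intro allI impI)
  fix x L assume "weakly_greedy x L"
  from removal_optimalD[OF assms this, of "{}"]
  show "norm (x - proj L x) \<le> C * norm x"
    by (simp add: proj_def)
qed

text \<open>
  For disjoint \<open>A\<close> and \<open>B\<close> this compares removing \<open>B\<close> with removing \<open>A\<close> from the sum of the two
  parts. In general it is applied twice, with a constant sum over a far set in between: once with
  the far set as the greedy part and once with the far set as the competitor.
\<close>

lemma removal_optimal_imp_large_dominates_small: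
  assumes "removal_optimal C" "C > 0"
  shows "large_dominates_small (C * C)"
  unfolding large_dominates_small_def
proof (intro allI impI)
  fix A B :: "nat set" and c b :: "nat \<Rightarrow> real"
  assume A: "finite A" and B: "finite B" and card: "card A \<le> card B"
    and le: "\<forall>i\<in>A. \<forall>k\<in>B. \<bar>c i\<bar> \<le> \<bar>b k\<bar>"
  have disjoint: "norm (\<Sum>n\<in>A. c n *\<^sub>R e n) \<le> C * norm (\<Sum>n\<in>B. b n *\<^sub>R e n)"
    if "finite A" "finite B" "A \<inter> B = {}" "card A \<le> card B"
      "\<And>i. i \<in> A \<Longrightarrow> \<bar>c i\<bar> \<le> t" "\<And>k. k \<in> B \<Longrightarrow> t \<le> \<bar>b k\<bar>" "t \<ge> 0" for A B c b t
    using removal_optimalD[OF assms(1) large_part_of_disjoint_sum(1)[OF that(1-3,5-7)] that(1,4)]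
    by (simp add: large_part_of_disjoint_sum[OF that(1-3,5-7)])
  obtain t where t: "t \<ge> 0" "\<And>i. i \<in> A \<Longrightarrow> \<bar>c i\<bar> \<le> t" "\<And>k. k \<in> B \<Longrightarrow> t \<le> \<bar>b k\<bar>"
    using separating_threshold[OF A, of B c b] le by metis
  obtain F where F: "finite F" "card F = card A" and far: "\<And>i n. i \<in> A \<union> B \<Longrightarrow> n \<in> F \<Longrightarrow> i < n"
    using far_set[of "A \<union> B" "card A"] A B by auto
  have dis: "A \<inter> F = {}" "F \<inter> B = {}"
    using far by fastforce+
  have "norm (\<Sum>n\<in>A. c n *\<^sub>R e n) \<le> C * norm (\<Sum>n\<in>F. t *\<^sub>R e n)"
    using t F by (intro disjoint[where t = t] A dis) auto
  also have "\<dots> \<le> C * (C * norm (\<Sum>n\<in>B. b n *\<^sub>R e n))"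
    using t F card assms(2) by (intro mult_left_mono disjoint[where t = t] B dis) auto
  finally show "norm (\<Sum>n\<in>A. c n *\<^sub>R e n) \<le> C * C * norm (\<Sum>n\<in>B. b n *\<^sub>R e n)"
    by (simp add: mult.assoc)
qed

text \<open>
  Greediness of \<open>L\<close> for \<open>x\<close> makes \<open>L - A\<close> greedy for \<open>y = x - proj A x\<close>, where \<open>x\<close> and \<open>y\<close> agree
  on \<open>L - A\<close>. The remainder of \<open>x\<close> is that of \<open>y\<close> plus \<open>proj (A - L) x\<close>, and the last term is
  dominated by \<open>proj (L - A) x = proj (L - A) y\<close>, hence by \<open>y\<close>.
\<close>

lemma almost_greedyI:
  assumes QG: "quasi_greedy C" and dom: "large_dominates_small K" and pos: "C > 0" "K > 0"
  shows "almost_greedy e e'"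
proof -
  define M where "M = C + K * (1 + C)"
  have M: "M > 0"
    using pos by (simp add: M_def add_pos_pos)
  have "norm (x - greedy_sum e e' m x) \<le> M * norm (x - proj A x)"
    if A: "finite A" "card A = m" for x m A
  proof -
    define L where "L = greedy_set e' m x"
    have L: "finite L" "card L = m" "weakly_greedy x L"
      unfolding L_def by (rule greedy_set_props)+
    define y where "y = x - proj A x"
    have coefy: "coef n y = (if n \<in> A then 0 else coef n x)" for n
      by (simp add: y_def proj_def blinfun.diff_right coef_sum A(1))
    have greedy: "weakly_greedy y (L - A)"
      using L(1,3) unfolding weakly_greedy_def coefy by auto
    have split: "proj A x = proj (A \<inter> L) x + proj (A - L) x" "proj L x = proj (A \<inter> L) x + proj (L - A) x"
      using A(1) L(1) by (subst proj_Un_disjoint[symmetric]; auto intro: arg_cong[of _ _ "\<lambda>A. proj A x"])+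
    have projy: "proj (L - A) y = proj (L - A) x"
      by (intro proj_cong) (simp add: coefy)
    have "x - proj L x = (y - proj (L - A) y) + proj (A - L) x"
      unfolding projy unfolding y_def split by simp
    then have "norm (x - proj L x) \<le> norm (y - proj (L - A) y) + norm (proj (A - L) x)"
      using norm_triangle_ineq by metis
    also have "norm (proj (A - L) x) \<le> K * norm (proj (L - A) y)"
      unfolding projy unfolding proj_def
    proof (rule large_dominates_smallD[OF dom])
      show "card (A - L) \<le> card (L - A)"
        using A L(1,2) by (simp add: card_Diff_subset_Int Int_commute)
    qed (use A L in \<open>auto simp: weakly_greedy_def\<close>)
    also have "\<dots> \<le> K * ((1 + C) * norm y)"
      using pos by (intro mult_left_mono quasi_greedy_proj[OF QG greedy]) auto
    also have "norm (y - proj (L - A) y) \<le> C * norm y"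
      by (rule quasi_greedyD[OF QG greedy])
    finally show ?thesis
      by (simp add: M_def y_def L_def greedy_sum_def proj_def algebra_simps)
  qed
  then have bound: "norm (x - greedy_sum e e' m x) / M \<le> norm (x - proj A x)"
    if "finite A" "card A = m" for x m A
    using that M by (simp add: pos_divide_le_eq mult.commute)
  have "norm (x - greedy_sum e e' m x) / M \<le> sigma_tilde e e' m x" for x m
    unfolding sigma_tilde_def
  proof (rule cInf_greatest)
    have "finite {..<m} \<and> card {..<m} = m"
      by simp
    then show "{norm (x - (\<Sum>n\<in>A. coef n x *\<^sub>R e n)) |A. finite A \<and> card A = m} \<noteq> {}"
      by blast
  qed (use bound in \<open>auto simp: proj_def\<close>)
  then have "norm (x - greedy_sum e e' m x) \<le> M * sigma_tilde e e' m x" for x m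
    using M by (simp add: pos_divide_le_eq mult.commute)
  then show ?thesis
    unfolding almost_greedy_def using M by blast
qed


section \<open>Approximation by constant-coefficient sums\<close>

definition greedy_beats_constant :: "real \<Rightarrow> bool" where
  "greedy_beats_constant C \<longleftrightarrow> (\<forall>x L A \<alpha>. weakly_greedy x L \<longrightarrow> L \<noteq> {} \<longrightarrow> finite A \<longrightarrow>
     card A = card L \<longrightarrow> set_before A L \<or> set_before L A \<longrightarrow>
     norm (x - proj L x) \<le> C * norm (x - \<alpha> *\<^sub>R (\<Sum>n\<in>A. e n)))"

lemma greedy_beats_constantD:
  "greedy_beats_constant C \<Longrightarrow> weakly_greedy x L \<Longrightarrow> L \<noteq> {} \<Longrightarrow> finite A \<Longrightarrow> card A = card L \<Longrightarrow>
     set_before A L \<or> set_before L A \<Longrightarrow>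
     norm (x - proj L x) \<le> C * norm (x - \<alpha> *\<^sub>R (\<Sum>n\<in>A. e n))"
  unfolding greedy_beats_constant_def by blast

lemma set_beforeI:
  assumes "finite A" "finite B" "A \<noteq> {}" "B \<noteq> {}" "\<And>i k. i \<in> A \<Longrightarrow> k \<in> B \<Longrightarrow> i < k"
  shows "set_before A B"
  using assms unfolding set_before_def by simp

lemma set_before_imp_disjoint:
  assumes "finite A" "finite B" "set_before A B"
  shows "A \<inter> B = {}"
  using assms Max_ge[of A] Min_le[of B] unfolding set_before_def by fastforce

lemma H_error_le:
  assumes "finite A" "card A = m"
    "set_before A (greedy_set e' m x) \<or> set_before (greedy_set e' m x) A"
  shows "H_error e e' m x \<le> norm (x - \<alpha> *\<^sub>R (\<Sum>n\<in>A. e n))"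
  unfolding H_error_def using assms by (intro cInf_lower bdd_belowI[of _ 0]) auto

text \<open>
  The infimum of an empty set is unspecified, so admissible competitors must be exhibited; a set to
  the right of the greedy set is one.
\<close>

lemma le_H_errorI:
  assumes "m \<ge> 1"
    and bound: "\<And>\<alpha> A. finite A \<Longrightarrow> card A = m \<Longrightarrow>
      set_before A (greedy_set e' m x) \<or> set_before (greedy_set e' m x) A \<Longrightarrow>
      r \<le> norm (x - \<alpha> *\<^sub>R (\<Sum>n\<in>A. e n))"
  shows "r \<le> H_error e e' m x"
  unfolding H_error_def
proof (rule cInf_greatest)
  note L = greedy_set_props[where m = m and x = x]
  obtain F where F: "finite F" "card F = m" "\<And>i n. i \<in> greedy_set e' m x \<Longrightarrow> n \<in> F \<Longrightarrow> i < n"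
    using far_set[OF L(1)] by metis
  have "set_before (greedy_set e' m x) F"
    using F L assms(1) by (intro set_beforeI) auto
  then show "{norm (x - \<alpha> *\<^sub>R (\<Sum>n\<in>A. e n)) | \<alpha> A. finite A \<and> card A = m \<and>
      (set_before A (greedy_set e' m x) \<or> set_before (greedy_set e' m x) A)} \<noteq> {}"
    using F(1,2) by blast
qed (use bound in blast)

text \<open>
  Perturbation removes the ties. The constant is raised to at least \<open>1\<close> because quasi-greediness
  also speaks of the empty set.
\<close>

lemma H_bound_imp_greedy_beats_constant:
  assumes "C > 0"
    and H: "\<And>x m. m \<ge> 1 \<Longrightarrow> norm (x - greedy_sum e e' m x) \<le> C * H_error e e' m x"
  shows "greedy_beats_constant (max 1 C)"
  unfolding greedy_beats_constant_def
proof (intro allI impI)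
  fix x L A \<alpha>
  assume L: "weakly_greedy x L" "L \<noteq> {}" and A: "finite A" "card A = card L"
    and before: "set_before A L \<or> set_before L A"
  obtain X where X: "X \<longlonglongrightarrow> x" "\<And>k. greedy_set e' (card L) (X k) = L"
      "\<And>k. X k - greedy_sum e e' (card L) (X k) = x - proj L x"
    using weakly_greedy_approx[OF L(1)] by metis
  have "card L \<ge> 1"
    using L unfolding weakly_greedy_def by (simp add: Suc_leI card_gt_0_iff)
  then have "norm (x - proj L x) \<le> C * H_error e e' (card L) (X k)" for k
    using H[of "card L" "X k"] by (simp add: X(3))
  moreover have "C * H_error e e' (card L) (X k) \<le> C * norm (X k - \<alpha> *\<^sub>R (\<Sum>n\<in>A. e n))" for k
    using assms(1) A before by (intro mult_left_mono H_error_le) (auto simp: X(2))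
  ultimately have "norm (x - proj L x) \<le> C * norm (X k - \<alpha> *\<^sub>R (\<Sum>n\<in>A. e n))" for k
    using order_trans by blast
  moreover have "(\<lambda>k. C * norm (X k - \<alpha> *\<^sub>R (\<Sum>n\<in>A. e n))) \<longlonglongrightarrow> C * norm (x - \<alpha> *\<^sub>R (\<Sum>n\<in>A. e n))"
    by (intro tendsto_intros X(1))
  ultimately have "norm (x - proj L x) \<le> C * norm (x - \<alpha> *\<^sub>R (\<Sum>n\<in>A. e n))"
    by (intro LIMSEQ_le_const) auto
  also have "\<dots> \<le> max 1 C * norm (x - \<alpha> *\<^sub>R (\<Sum>n\<in>A. e n))"
    by (intro mult_right_mono) auto
  finally show "norm (x - proj L x) \<le> max 1 C * norm (x - \<alpha> *\<^sub>R (\<Sum>n\<in>A. e n))" .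
qed

lemma greedy_beats_constant_imp_quasi_greedy:
  assumes "greedy_beats_constant C" "C \<ge> 1"
  shows "quasi_greedy C"
  unfolding quasi_greedy_def
proof (intro allI impI)
  fix x L assume L: "weakly_greedy x L"
  show "norm (x - proj L x) \<le> C * norm x"
  proof (cases "L = {}")
    case True
    then show ?thesis
      using assms(2) mult_right_mono[of 1 C "norm x"] by (simp add: proj_def)
  next
    case False
    have fin: "finite L"
      using L unfolding weakly_greedy_def by blast
    obtain F where F: "finite F" "card F = card L" "\<And>i n. i \<in> L \<Longrightarrow> n \<in> F \<Longrightarrow> i < n"
      using far_set[OF fin] by metis
    have "set_before L F"
      using F fin False by (intro set_beforeI) auto
    then show ?thesis
      using greedy_beats_constantD[OF assms(1) L False F(1,2), of 0] by simp
  qed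
qed

text \<open>
  A point of a cube is a convex combination of its vertices, and the norm is convex. The offset
  \<open>v\<close> is there for the induction, which moves the coordinates to a vertex one at a time.
\<close>

lemma norm_sum_le_of_subset_sums:
  fixes f :: "'b \<Rightarrow> 'a"
  assumes "finite A" "\<And>n. n \<in> A \<Longrightarrow> 0 \<le> p n \<and> p n \<le> 1"
    and "\<And>B. B \<subseteq> A \<Longrightarrow> norm (v + (\<Sum>n\<in>B. f n)) \<le> M"
  shows "norm (v + (\<Sum>n\<in>A. p n *\<^sub>R f n)) \<le> M"
  using assms
proof (induction A arbitrary: v rule: finite_induct)
  case empty
  then show ?case by simp
next
  case (insert a A)
  have "norm (v + p a *\<^sub>R f a + (\<Sum>n\<in>B. f n)) \<le> M" if B: "B \<subseteq> A" for B
  proof -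
    let ?s = "v + (\<Sum>n\<in>B. f n)"
    have "a \<notin> B" "finite B"
      using B insert.hyps finite_subset by auto
    then have without: "norm ?s \<le> M" and "with": "norm (?s + f a) \<le> M"
      using insert.prems(2)[of B] insert.prems(2)[of "insert a B"] B by (auto simp: algebra_simps)
    have p: "0 \<le> p a" "p a \<le> 1"
      using insert.prems(1)[of a] by auto
    have "v + p a *\<^sub>R f a + (\<Sum>n\<in>B. f n) = (1 - p a) *\<^sub>R ?s + p a *\<^sub>R (?s + f a)"
      by (simp add: algebra_simps)
    also have "norm \<dots> \<le> (1 - p a) * norm ?s + p a * norm (?s + f a)"
      using p by (intro norm_triangle_le) auto
    also have "\<dots> \<le> (1 - p a) * M + p a * M"
      using p without "with" by (intro add_mono mult_left_mono) auto
    also have "\<dots> = M"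
      by (simp add: algebra_simps)
    finally show ?thesis .
  qed
  then have "norm (v + p a *\<^sub>R f a + (\<Sum>n\<in>A. p n *\<^sub>R f n)) \<le> M"
    using insert.prems(1) by (intro insert.IH) auto
  then show ?case
    using insert.hyps by (simp add: add.assoc)
qed

lemma norm_sum_le_of_bounded_coefficients:
  assumes "finite A" "t \<ge> 0" "\<And>n. n \<in> A \<Longrightarrow> \<bar>c n\<bar> \<le> t"
    and M: "\<And>B. B \<subseteq> A \<Longrightarrow> norm (\<Sum>n\<in>B. t *\<^sub>R e n) \<le> M"
  shows "norm (\<Sum>n\<in>A. c n *\<^sub>R e n) \<le> 2 * M"
proof (cases "t = 0")
  case True
  then show ?thesis
    using assms(3) M[of "{}"] by simp
next
  case False
  \<comment> \<open>The positive and the negative part each lie in the cube; hence the factor \<open>2\<close>.\<close>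
  define p where "p n = max 0 (c n) / t" for n
  define q where "q n = max 0 (- c n) / t" for n
  have "c n *\<^sub>R e n = p n *\<^sub>R (t *\<^sub>R e n) - q n *\<^sub>R (t *\<^sub>R e n)" for n
    using False by (simp add: p_def q_def max_def scaleR_diff_left[symmetric])
  then have "(\<Sum>n\<in>A. c n *\<^sub>R e n) =
      (0 + (\<Sum>n\<in>A. p n *\<^sub>R (t *\<^sub>R e n))) - (0 + (\<Sum>n\<in>A. q n *\<^sub>R (t *\<^sub>R e n)))"
    by (simp only: sum_subtractf add_0)
  also have "norm \<dots> \<le> M + M"
  proof (intro norm_triangle_le_diff add_mono norm_sum_le_of_subset_sums[OF assms(1)])
    show "0 \<le> p n \<and> p n \<le> 1" "0 \<le> q n \<and> q n \<le> 1" if "n \<in> A" for n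
      using assms(2) assms(3)[of n] that False by (auto simp: p_def q_def)
  qed (use M in auto)
  finally show ?thesis
    by simp
qed

text \<open>
  Subtracting \<open>t\<close> times the indicator sum of \<open>A\<close> cancels the first part of the test vector
  exactly. This is why the coefficients on \<open>A\<close> have to be constant here.
\<close>

lemma greedy_beats_constant_disjoint_sum:
  assumes beats: "greedy_beats_constant C" and fin: "finite A" "finite B" and card: "card A = card B"
    and far: "(\<forall>i\<in>A. \<forall>k\<in>B. i < k) \<or> (\<forall>i\<in>A. \<forall>k\<in>B. k < i)"
    and t: "t \<ge> 0" "\<And>k. k \<in> B \<Longrightarrow> t \<le> \<bar>b k\<bar>"
  shows "norm (\<Sum>n\<in>A. t *\<^sub>R e n) \<le> C * norm (\<Sum>n\<in>B. b n *\<^sub>R e n)"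
proof (cases "B = {}")
  case True
  then show ?thesis
    using card fin by simp
next
  case False
  then have "A \<noteq> {}"
    using card fin by force
  then have before: "set_before A B \<or> set_before B A"
    using far fin False set_beforeI by metis
  have dis: "A \<inter> B = {}"
    using far by auto
  have tA: "\<And>i. i \<in> A \<Longrightarrow> \<bar>t\<bar> \<le> t"
    using t by simp
  note w = large_part_of_disjoint_sum[where c = "\<lambda>_. t" and b = b and t = t, OF fin dis tA t(2) t(1)]
  show ?thesis
    using greedy_beats_constantD[OF beats w(1) False fin(1) card before, where \<alpha> = t] w(3)
    by (simp add: scaleR_sum_right)
qed

text \<open>
  By convexity it suffices to bound constant sums over subsets \<open>D\<close> of \<open>A\<close>. With \<open>F\<close> a far set of
  the size of \<open>B\<close> and \<open>E\<close> a subset of \<open>F\<close> of the size of \<open>D\<close>, the comparison goes from \<open>D\<close> to \<open>E\<close>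
  to \<open>F\<close> to \<open>B\<close>. The sizes agree in the first and the last step, which compare a
  removed set with a subtracted one; quasi-greediness changes the size in the middle.
\<close>

lemma greedy_beats_constant_imp_large_dominates_small:
  assumes beats: "greedy_beats_constant C" and "C \<ge> 1"
  shows "large_dominates_small (2 * C ^ 3)"
  unfolding large_dominates_small_def
proof (intro allI impI)
  fix A B :: "nat set" and c b :: "nat \<Rightarrow> real"
  assume A: "finite A" and B: "finite B" and card: "card A \<le> card B"
    and le: "\<forall>i\<in>A. \<forall>k\<in>B. \<bar>c i\<bar> \<le> \<bar>b k\<bar>"
  let ?b = "\<Sum>n\<in>B. b n *\<^sub>R e n"
  obtain t where t: "t \<ge> 0" "\<And>i. i \<in> A \<Longrightarrow> \<bar>c i\<bar> \<le> t" "\<And>k. k \<in> B \<Longrightarrow> t \<le> \<bar>b k\<bar>"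
    using separating_threshold[OF A, of B c b] le by metis
  have "norm (\<Sum>n\<in>D. t *\<^sub>R e n) \<le> C ^ 3 * norm ?b" if D: "D \<subseteq> A" for D
  proof -
    have finD: "finite D" and cardD: "card D \<le> card B"
      using D A card finite_subset card_mono le_trans by metis+
    obtain F where F: "finite F" "card F = card B" and far: "\<And>i n. i \<in> D \<union> B \<Longrightarrow> n \<in> F \<Longrightarrow> i < n"
      using far_set[of "D \<union> B" "card B"] finD B by auto
    obtain E where E: "E \<subseteq> F" "card E = card D"
      using obtain_subset_with_card_n cardD F(2) by metis
    have finE: "finite E"
      using E F finite_subset by blast
    have "norm (\<Sum>n\<in>D. t *\<^sub>R e n) \<le> C * norm (\<Sum>n\<in>E. t *\<^sub>R e n)"
      using far E t(1) by (intro greedy_beats_constant_disjoint_sum[OF beats finD finE]) auto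
    also have "norm (\<Sum>n\<in>E. t *\<^sub>R e n) \<le> C * norm (\<Sum>n\<in>F. t *\<^sub>R e n)"
    proof -
      let ?u = "\<Sum>n\<in>F. t *\<^sub>R e n"
      \<comment> \<open>All coefficients of \<open>?u\<close> on \<open>F\<close> are tied, so any subset of \<open>F\<close> may be removed greedily.\<close>
      have "weakly_greedy ?u (F - E)"
        using F(1) E(1) t(1) by (intro weakly_greedyI[of _ t]) (auto simp: coef_sum)
      then have "norm (?u - proj (F - E) ?u) \<le> C * norm ?u"
        by (rule quasi_greedyD[OF greedy_beats_constant_imp_quasi_greedy[OF assms]])
      moreover have "(F - E) \<inter> F = F - E"
        by blast
      then have "?u - proj (F - E) ?u = (\<Sum>n\<in>E. t *\<^sub>R e n)"
        using F(1) E(1) by (simp add: proj_sum sum_diff)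
      ultimately show ?thesis
        by simp
    qed
    also have "norm (\<Sum>n\<in>F. t *\<^sub>R e n) \<le> C * norm ?b"
      using far t F(2) by (intro greedy_beats_constant_disjoint_sum[OF beats F(1) B]) auto
    finally show ?thesis
      using assms(2) by (simp add: power3_eq_cube mult.assoc)
  qed
  then show "norm (\<Sum>n\<in>A. c n *\<^sub>R e n) \<le> 2 * C ^ 3 * norm ?b"
    using norm_sum_le_of_bounded_coefficients[where t = t and M = "C ^ 3 * norm ?b", OF A t(1,2)] by (simp add: mult.assoc)
qed

text \<open>
  Let \<open>t\<close> be the smallest modulus of a coefficient of \<open>x\<close> on \<open>L\<close>. Subtracting \<open>\<alpha>\<close> on \<open>A\<close> may
  create new coefficients larger than \<open>t\<close>; enlarging \<open>L\<close> by their indices \<open>D\<close> gives a greedy set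
  \<open>G\<close> of \<open>y\<close>. The remainders of \<open>x\<close> and \<open>y\<close> differ by \<open>proj A x - proj (A - D) y\<close>. The coefficients
  of both terms are at most \<open>t\<close> in modulus, and both have at most \<open>card G\<close> terms, so \<open>proj G y\<close> dominates
  them.
\<close>

lemma norm_greedy_remainder_le_constant_error:
  assumes QG: "quasi_greedy C" and dom: "large_dominates_small K" and pos: "C > 0" "K > 0"
    and L: "weakly_greedy x L" "L \<noteq> {}"
    and A: "finite A" "card A \<le> card L" "A \<inter> L = {}"
  shows "norm (x - proj L x) \<le> (C + 2 * K * (1 + C)) * norm (x - \<alpha> *\<^sub>R (\<Sum>n\<in>A. e n))"
proof -
  define y where "y = x - \<alpha> *\<^sub>R (\<Sum>n\<in>A. e n)"
  have finL: "finite L"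
    using L unfolding weakly_greedy_def by blast
  define t where "t = Min ((\<lambda>n. \<bar>coef n x\<bar>) ` L)"
  have tL: "t \<le> \<bar>coef n x\<bar>" if "n \<in> L" for n
    using that finL by (simp add: t_def)
  have tnL: "\<bar>coef n x\<bar> \<le> t" if "n \<notin> L" for n
    using that L finL by (simp add: t_def weakly_greedy_def)
  have y: "y = x - (\<Sum>n\<in>A. \<alpha> *\<^sub>R e n)"
    by (simp add: y_def scaleR_sum_right)
  have coefy: "coef n y = coef n x - (if n \<in> A then \<alpha> else 0)" for n
    by (simp add: y blinfun.diff_right coef_sum A(1))
  define D where "D = {n \<in> A. \<bar>coef n y\<bar> > t}"
  have D: "finite D" "D \<subseteq> A"
    using A(1) by (auto simp: D_def)
  define G where "G = L \<union> D"
  have G: "finite G" "\<And>n. n \<in> G \<Longrightarrow> t \<le> \<bar>coef n y\<bar>" "card A \<le> card G"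
  proof -
    show "finite G"
      using finL D by (simp add: G_def)
    then have "card L \<le> card G"
      by (intro card_mono) (auto simp: G_def)
    then show "card A \<le> card G"
      using A(2) by simp
    show "t \<le> \<bar>coef n y\<bar>" if "n \<in> G" for n
      using that tL[of n] A(3) by (auto simp: G_def D_def coefy)
  qed
  have greedy: "weakly_greedy y G"
    using G(1,2) tnL by (intro weakly_greedyI[of _ t]) (auto simp: G_def D_def coefy)
  have "proj G y = proj L x + proj D y"
  proof -
    have "proj L y = proj L x"
      using A(3) by (intro proj_cong) (auto simp: coefy)
    then show ?thesis
      using proj_Un_disjoint[OF finL D(1), of y] D(2) A(3) by (auto simp: G_def)
  qed
  moreover have "proj A x - (\<Sum>n\<in>A. \<alpha> *\<^sub>R e n) = proj D y + proj (A - D) y"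
  proof -
    have "proj A x - (\<Sum>n\<in>A. \<alpha> *\<^sub>R e n) = proj A y"
      using A(1) by (simp add: y proj_diff proj_sum)
    also have "\<dots> = proj D y + proj (A - D) y"
      using D A(1) by (subst proj_Un_disjoint[symmetric]) (auto intro!: arg_cong[of _ _ "\<lambda>A. proj A y"])
    finally show ?thesis .
  qed
  ultimately have "x - proj L x = (y - proj G y) + (proj A x - proj (A - D) y)"
    by (simp add: y algebra_simps)
  then have "norm (x - proj L x) \<le>
      norm (y - proj G y) + (norm (proj A x) + norm (proj (A - D) y))"
    by (metis norm_triangle_ineq norm_triangle_ineq4 add_left_mono order_trans)
  also have "norm (proj A x) \<le> K * norm (proj G y)"
    unfolding proj_def
  proof (rule large_dominates_smallD[OF dom A(1) G(1,3)])
    show "\<bar>coef i x\<bar> \<le> \<bar>coef k y\<bar>" if "i \<in> A" "k \<in> G" for i k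
      using that A(3) tnL[of i] G(2)[of k] by fastforce
  qed
  also have "norm (proj (A - D) y) \<le> K * norm (proj G y)"
    unfolding proj_def
  proof (rule large_dominates_smallD[OF dom _ G(1)])
    show "finite (A - D)"
      using A(1) by simp
    show "card (A - D) \<le> card G"
      using G(3) card_mono[of A "A - D"] A(1) by force
    show "\<bar>coef i y\<bar> \<le> \<bar>coef k y\<bar>" if "i \<in> A - D" "k \<in> G" for i k
      using that G(2)[of k] by (auto simp: D_def)
  qed
  also have "norm (y - proj G y) \<le> C * norm y"
    by (rule quasi_greedyD[OF QG greedy])
  also have "K * norm (proj G y) \<le> K * ((1 + C) * norm y)"
    using pos by (intro mult_left_mono quasi_greedy_proj[OF QG greedy]) auto
  finally show ?thesis
    by (simp add: y_def algebra_simps)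
qed

lemma H_boundI:
  assumes "quasi_greedy C" "large_dominates_small K" "C > 0" "K > 0"
  shows "\<exists>M>0. \<forall>x. \<forall>m\<ge>1. norm (x - greedy_sum e e' m x) \<le> M * H_error e e' m x"
proof -
  define M where "M = C + 2 * K * (1 + C)"
  have M: "M > 0"
    using assms(3,4) by (simp add: M_def add_pos_pos)
  have "norm (x - greedy_sum e e' m x) \<le> M * H_error e e' m x" if m: "m \<ge> 1" for x m
  proof -
    note L = greedy_set_props[where m = m and x = x]
    have "norm (x - greedy_sum e e' m x) / M \<le> H_error e e' m x"
    proof (rule le_H_errorI[OF m])
      fix \<alpha> A
      assume A: "finite A" "card A = m"
        and "set_before A (greedy_set e' m x) \<or> set_before (greedy_set e' m x) A"
      then have "A \<inter> greedy_set e' m x = {}"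
        using set_before_imp_disjoint A(1) L(1) by blast
      then have "norm (x - proj (greedy_set e' m x) x) \<le> M * norm (x - \<alpha> *\<^sub>R (\<Sum>n\<in>A. e n))"
        unfolding M_def using A L m
        by (intro norm_greedy_remainder_le_constant_error assms) auto
      then show "norm (x - greedy_sum e e' m x) / M \<le> norm (x - \<alpha> *\<^sub>R (\<Sum>n\<in>A. e n))"
        using M by (simp add: greedy_sum_def proj_def pos_divide_le_eq mult.commute)
    qed
    then show ?thesis
      using M by (simp add: pos_divide_le_eq mult.commute)
  qed
  then show ?thesis
    using M by blast
qed

end


section \<open>The characterization\<close>

theorem corollary4p5:
  fixes e :: "nat \<Rightarrow> 'a::banach" and e' :: "nat \<Rightarrow> 'a \<Rightarrow>\<^sub>L real"
  assumes "seminormalized_schauder_basis e e'"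
  shows "almost_greedy e e' \<longleftrightarrow>
    (\<exists>C>0. \<forall>x. \<forall>m\<ge>1. norm (x - greedy_sum e e' m x) \<le> C * H_error e e' m x)"
proof -
  interpret seminormalized_basis e e'
    by unfold_locales (rule assms)
  show ?thesis
  proof
    assume "almost_greedy e e'"
    then obtain C where C: "C > 0" "removal_optimal C"
      by (rule almost_greedy_imp_removal_optimal)
    show "\<exists>C>0. \<forall>x. \<forall>m\<ge>1. norm (x - greedy_sum e e' m x) \<le> C * H_error e e' m x"
      using C by (intro H_boundI[of C "C * C"] removal_optimal_imp_quasi_greedy
          removal_optimal_imp_large_dominates_small) auto
  next
    assume "\<exists>C>0. \<forall>x. \<forall>m\<ge>1. norm (x - greedy_sum e e' m x) \<le> C * H_error e e' m x"
    then obtain C0 where "C0 > 0"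
      "\<And>x m. m \<ge> 1 \<Longrightarrow> norm (x - greedy_sum e e' m x) \<le> C0 * H_error e e' m x"
      by blast
    then have beats: "greedy_beats_constant (max 1 C0)"
      by (rule H_bound_imp_greedy_beats_constant)
    show "almost_greedy e e'"
      using beats by (intro almost_greedyI[of "max 1 C0" "2 * max 1 C0 ^ 3"]
          greedy_beats_constant_imp_quasi_greedy greedy_beats_constant_imp_large_dominates_small) auto
  qed
qed

end
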